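(* Let $G$ be a cograph. Then $G$ is ideally connected if and only if $G$ is $2K_2$-free.
   Context: All graphs are finite and simple. A graph is a cograph if it has no induced subgraph isomorphic to $P_4$, the path on four vertices. For a graph $H$, a graph $G$ is $H$-free if no induced subgraph of $G$ is isomorphic to $H$; $2K_2$ is the disjoint union of two copies of $K_2$ (four vertices, two disjoint edges). For distinct vertices $u,v$ of $G$, $\kappa_G(u,v)$ denotes the maximum number of (pairwise distinct) internally disjoint $u$-$v$ paths in $G$ (the edge $uv$, if present, counts as one path). $G$ is ideally connected if $\kappa_G(u,v)=\min\{\deg_G(u),\deg_G(v)\}$ for every pair of distinct vertices $u,v\in V(G)$. *)

theory Defs
  imports "Graph_Theory.Graph_Theory"
begin

text \<open>
  A finite simple graph is a \<^locale>\<open>pair_graph\<close>: a finite, loop-free, symmetric digraph without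
  parallel arcs, in which the edge \<open>uv\<close> is the pair of arcs \<open>(u,v)\<close> and \<open>(v,u)\<close>.
\<close>

definition P4 :: "nat pair_pre_digraph" where
  "P4 = \<lparr> pverts = {0, 1, 2, 3},
          parcs = {(0, 1), (1, 0), (1, 2), (2, 1), (2, 3), (3, 2)} \<rparr>"

definition two_K2 :: "nat pair_pre_digraph" where
  "two_K2 = \<lparr> pverts = {0, 1, 2, 3}, parcs = {(0, 1), (1, 0), (2, 3), (3, 2)} \<rparr>"

lemma pair_graph_P4: "pair_graph P4"
  by unfold_locales (auto simp: P4_def symmetric_def sym_def)

lemma pair_graph_two_K2: "pair_graph two_K2"
  by unfold_locales (auto simp: two_K2_def symmetric_def sym_def)

definition induced_free :: "'h pair_pre_digraph \<Rightarrow> 'a pair_pre_digraph \<Rightarrow> bool" where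
  "induced_free H G \<longleftrightarrow>
     \<not> (\<exists>K. induced_subgraph K (with_proj G) \<and> digraph_iso K (with_proj H))"

definition cograph :: "'a pair_pre_digraph \<Rightarrow> bool" where
  "cograph G \<longleftrightarrow> induced_free P4 G"

text \<open>
  Paths are sequences of arcs directed from \<open>u\<close> to \<open>v\<close>, so for \<open>u \<noteq> v\<close> every undirected path between
  \<open>u\<close> and \<open>v\<close> occurs exactly once. The path consisting of the edge \<open>uv\<close> alone has no inner vertices.
\<close>

definition internally_disjoint_paths ::
    "'a pair_pre_digraph \<Rightarrow> 'a \<Rightarrow> 'a \<Rightarrow> ('a \<times> 'a) awalk set \<Rightarrow> bool" where
  "internally_disjoint_paths G u v Q \<longleftrightarrow>
     (\<forall>p\<in>Q. pre_digraph.apath (with_proj G) u p v) \<and>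
     (\<forall>p\<in>Q. \<forall>q\<in>Q. p \<noteq> q \<longrightarrow>
        set (pre_digraph.inner_verts (with_proj G) p) \<inter>
        set (pre_digraph.inner_verts (with_proj G) q) = {})"

definition local_connectivity :: "'a pair_pre_digraph \<Rightarrow> 'a \<Rightarrow> 'a \<Rightarrow> nat" where
  "local_connectivity G u v = Max {card Q | Q. internally_disjoint_paths G u v Q}"

text \<open>The maximum is over a finite nonempty set, and no family in it is infinite.\<close>

lemma (in pair_graph) internally_disjoint_paths_finite:
  shows "internally_disjoint_paths G u v Q \<Longrightarrow> finite Q"
    and "finite {card Q | Q. internally_disjoint_paths G u v Q}"
    and "{card Q | Q. internally_disjoint_paths G u v Q} \<noteq> {}"
proof -
  have fin: "finite {p. apath u p v}"
    by (rule apaths_finite)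
  have sub: "Q \<subseteq> {p. apath u p v}" if "internally_disjoint_paths G u v Q" for Q
    using that by (auto simp: internally_disjoint_paths_def)
  show "finite Q" if "internally_disjoint_paths G u v Q"
    using sub[OF that] fin by (rule finite_subset)
  have "{card Q | Q. internally_disjoint_paths G u v Q} \<subseteq> card ` Pow {p. apath u p v}"
    using sub by auto
  then show "finite {card Q | Q. internally_disjoint_paths G u v Q}"
    using fin by (meson finite_Pow_iff finite_imageI finite_subset)
  have "internally_disjoint_paths G u v {}"
    by (simp add: internally_disjoint_paths_def)
  then show "{card Q | Q. internally_disjoint_paths G u v Q} \<noteq> {}"
    by blast
qed

text \<open>In a symmetric digraph the degree of a vertex is its out-degree, the number of its neighbours.\<close>

definition ideally_connected :: "'a pair_pre_digraph \<Rightarrow> bool" where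
  "ideally_connected G \<longleftrightarrow>
     (\<forall>u\<in>pverts G. \<forall>v\<in>pverts G. u \<noteq> v \<longrightarrow>
        local_connectivity G u v =
        min (out_degree (with_proj G) u) (out_degree (with_proj G) v))"

end

theory Submission
  imports Defs
begin

text \<open>
  In a cograph, every path between two nonadjacent vertices \<open>u\<close> and \<open>v\<close> passes through a common
  neighbour, so \<open>\<kappa>(u,v)\<close> is the number of common neighbours. Hence the pair is ideal iff one of the
  neighbourhoods contains the other, and a private neighbour of \<open>u\<close> together with a private neighbour
  of \<open>v\<close> spans with \<open>u\<close> and \<open>v\<close> either a \<open>P\<^sub>4\<close> or a \<open>2K\<^sub>2\<close>. Adjacent vertices are always ideal in a
  cograph: private neighbours \<open>a\<close> of \<open>u\<close> and \<open>b\<close> of \<open>v\<close> must be adjacent, as \<open>a u v b\<close> would be an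
  induced \<open>P\<^sub>4\<close> otherwise, so the private neighbours can be matched up to give paths \<open>u a b v\<close>.
\<close>

section \<open>Induced subgraphs as embeddings\<close>

text \<open>Lets \<open>P4\<close> and \<open>two_K2\<close> be handled as four vertices with
  prescribed arcs. The inverse of an isomorphism from an induced subgraph onto \<open>H\<close> is
  an embedding of \<open>H\<close>; conversely, the image of an embedding induces a copy of
  \<open>H\<close>.\<close>

lemma not_induced_free_iff_embedding:
  assumes G: "pair_wf_digraph G" and H: "pair_wf_digraph H"
  shows "\<not> induced_free H G \<longleftrightarrow>
    (\<exists>f. inj_on f (pverts H) \<and> f ` pverts H \<subseteq> pverts G \<and>
      (\<forall>x\<in>pverts H. \<forall>y\<in>pverts H. (f x, f y) \<in> parcs G \<longleftrightarrow> (x, y) \<in> parcs H))"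
    (is "?L \<longleftrightarrow> ?R")
proof
  assume ?L
  then obtain K hom where K: "induced_subgraph K (with_proj G)"
    and hom: "pre_digraph.digraph_isomorphism K hom" and H_eq: "with_proj H = app_iso hom K"
    unfolding induced_free_def digraph_iso_def by blast
  let ?g = "iso_verts hom"
  let ?f = "the_inv_into (verts K) ?g"
  have K_sub: "verts K \<subseteq> pverts G" "tail K = fst" "head K = snd"
    and K_arcs: "arcs K = {e \<in> parcs G. fst e \<in> verts K \<and> snd e \<in> verts K}"
    using K by (auto simp: induced_subgraph_def subgraph_def compatible_def)
  have inj: "inj_on ?g (verts K)"
    using hom by (simp add: pre_digraph.digraph_isomorphism_def)
  have H_verts: "pverts H = ?g ` verts K" and H_arcs: "parcs H = iso_arcs hom ` arcs K"
    and "fst = iso_tail hom" "snd = iso_head hom"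
    using arg_cong[OF H_eq, of verts] arg_cong[OF H_eq, of arcs]
      arg_cong[OF H_eq, of tail] arg_cong[OF H_eq, of head] by simp_all
  \<comment> \<open>An isomorphism carries its own arc map. As tail and head are the projections on
    both sides, this map is determined by the vertex map.\<close>
  then have "iso_arcs hom e = (?g (fst e), ?g (snd e))" if "e \<in> arcs K" for e
    using hom that K_sub unfolding pre_digraph.digraph_isomorphism_def by (metis prod.collapse)
  then have H_arcs': "parcs H = (\<lambda>e. (?g (fst e), ?g (snd e))) ` arcs K"
    using H_arcs by auto
  have f_g: "?f (?g x) = x" if "x \<in> verts K" for x
    using inj that by (rule the_inv_into_f_f)
  have "inj_on ?f (pverts H)"
    unfolding H_verts by (intro inj_onI) (auto simp: f_g)
  moreover have "?f ` pverts H \<subseteq> pverts G"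
    using K_sub by (auto simp: H_verts f_g)
  moreover have "(?f (?g x), ?f (?g y)) \<in> parcs G \<longleftrightarrow> (?g x, ?g y) \<in> parcs H"
    if "x \<in> verts K" "y \<in> verts K" for x y
  proof -
    have "(?g x, ?g y) \<in> parcs H \<longleftrightarrow> (x, y) \<in> arcs K"
      using that inj by (force simp: H_arcs' K_arcs inj_on_eq_iff image_iff)
    then show ?thesis
      using that by (simp add: f_g K_arcs)
  qed
  ultimately show ?R
    unfolding H_verts by blast
next
  assume ?R
  then obtain f where inj: "inj_on f (pverts H)" and sub: "f ` pverts H \<subseteq> pverts G"
    and arcs: "\<And>x y. x \<in> pverts H \<Longrightarrow> y \<in> pverts H \<Longrightarrow> (f x, f y) \<in> parcs G \<longleftrightarrow> (x, y) \<in> parcs H"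
    by blast
  interpret G: pair_wf_digraph G by fact
  interpret H: pair_wf_digraph H by fact
  \<comment> \<open>The isomorphism runs from the induced subgraph to \<open>H\<close>, so it is
    built from the inverse of \<open>f\<close>.\<close>
  let ?K = "with_proj G \<restriction> f ` pverts H"
  let ?g = "the_inv_into (pverts H) f"
  let ?hom = "\<lparr>iso_verts = ?g, iso_arcs = map_prod ?g ?g, iso_head = snd, iso_tail = fst\<rparr>"
  have g_f: "?g (f x) = x" if "x \<in> pverts H" for x
    using inj that by (rule the_inv_into_f_f)
  have ind: "induced_subgraph ?K (with_proj G)"
    using sub by (intro G.induced_induce) auto
  have "inj_on ?g (f ` pverts H)"
    using inj by (rule inj_on_the_inv_into)
  then have "inj_on (map_prod ?g ?g) (arcs ?K)"
    by (auto simp: inj_on_def)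
  then have "pre_digraph.digraph_isomorphism ?K ?hom"
    using \<open>inj_on ?g _\<close> by (auto simp: pre_digraph.digraph_isomorphism_def)
  moreover have "with_proj H = app_iso ?hom ?K"
  proof (rule pre_digraph.equality)
    show "arcs (with_proj H) = arcs (app_iso ?hom ?K)"
    proof (intro equalityI subsetI)
      fix e assume "e \<in> arcs (with_proj H)"
      then have "e \<in> parcs H" "fst e \<in> pverts H" "snd e \<in> pverts H"
        using H.arc_fst_in_verts H.arc_snd_in_verts by auto
      then have "(f (fst e), f (snd e)) \<in> arcs ?K" "e = map_prod ?g ?g (f (fst e), f (snd e))"
        by (simp_all add: arcs g_f)
      then show "e \<in> arcs (app_iso ?hom ?K)"
        by (metis app_iso_simps(2) digraph_isomorphism.select_convs(2) image_eqI)
    qed (auto simp: g_f arcs)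
  qed (auto simp: g_f image_image)
  ultimately show ?L
    using ind unfolding induced_free_def digraph_iso_def by blast
qed

context pair_graph
begin

lemma arc_sym_iff: "(x, y) \<in> parcs G \<longleftrightarrow> (y, x) \<in> parcs G"
  using arcs_symmetric by blast

lemma arc_in_pverts: "(x, y) \<in> parcs G \<Longrightarrow> x \<in> pverts G \<and> y \<in> pverts G"
  using arc_fst_in_verts arc_snd_in_verts by fastforce

text \<open>The working form of the cograph property: a path \<open>a b c d\<close> lacking the
  chords \<open>ac\<close> and \<open>bd\<close> must close up to a 4-cycle.\<close>

lemma cograph_no_induced_P4:
  assumes "cograph G" and "(a, b) \<in> parcs G" "(b, c) \<in> parcs G" "(c, d) \<in> parcs G"
    and "(a, c) \<notin> parcs G" "(b, d) \<notin> parcs G" "a \<noteq> d"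
  shows "(a, d) \<in> parcs G"
proof (rule ccontr)
  assume "(a, d) \<notin> parcs G"
  \<comment> \<open>If \<open>a = c\<close>, the arc \<open>(c, d)\<close> would be the excluded
    \<open>(a, d)\<close>; if \<open>b = d\<close>, the arc \<open>(a, b)\<close> would be.\<close>
  moreover from this have "a \<noteq> c" "b \<noteq> d"
    using assms by auto
  moreover have "a \<noteq> b" "b \<noteq> c" "c \<noteq> d"
    using assms no_loops' by blast+
  moreover have "(x, x) \<notin> parcs G" for x
    using no_loops' by blast
  moreover define f where "f = (\<lambda>i::nat. [a, b, c, d] ! i)"
  ultimately have "inj_on f (pverts P4)" "f ` pverts P4 \<subseteq> pverts G"
    "\<forall>x\<in>pverts P4. \<forall>y\<in>pverts P4. (f x, f y) \<in> parcs G \<longleftrightarrow> (x, y) \<in> parcs P4"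
    using assms arc_in_pverts arc_sym_iff
    by (auto simp: P4_def numeral_eq_Suc)
  then have "\<not> induced_free P4 G"
    using not_induced_free_iff_embedding[of G P4] pair_graph_P4
    by (auto simp: pair_graph_def pair_digraph_def pair_fin_digraph_def)
  then show False
    using \<open>cograph G\<close> by (simp add: cograph_def)
qed

lemma not_two_K2_free_iff:
  "\<not> induced_free two_K2 G \<longleftrightarrow>
    (\<exists>a b c d. (a, b) \<in> parcs G \<and> (c, d) \<in> parcs G \<and> a \<noteq> c \<and>
      (a, c) \<notin> parcs G \<and> (a, d) \<notin> parcs G \<and> (b, c) \<notin> parcs G \<and> (b, d) \<notin> parcs G)"
    (is "_ \<longleftrightarrow> ?R")
proof -
  have emb: "\<not> induced_free two_K2 G \<longleftrightarrow>
    (\<exists>f. inj_on f (pverts two_K2) \<and> f ` pverts two_K2 \<subseteq> pverts G \<and>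
      (\<forall>x\<in>pverts two_K2. \<forall>y\<in>pverts two_K2. (f x, f y) \<in> parcs G \<longleftrightarrow> (x, y) \<in> parcs two_K2))"
      (is "_ \<longleftrightarrow> ?E")
    using pair_graph_two_K2 by (intro not_induced_free_iff_embedding)
      (auto simp: pair_graph_def pair_digraph_def pair_fin_digraph_def)
  have "?E \<longleftrightarrow> ?R"
  proof
    assume ?E
    then obtain f where "inj_on f (pverts two_K2)"
      "\<forall>x\<in>pverts two_K2. \<forall>y\<in>pverts two_K2. (f x, f y) \<in> parcs G \<longleftrightarrow> (x, y) \<in> parcs two_K2"
      by blast
    then have "(f 0, f 1) \<in> parcs G \<and> (f 2, f 3) \<in> parcs G \<and> f 0 \<noteq> f 2 \<and>
      (f 0, f 2) \<notin> parcs G \<and> (f 0, f 3) \<notin> parcs G \<and> (f 1, f 2) \<notin> parcs G \<and> (f 1, f 3) \<notin> parcs G"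
      by (auto simp: two_K2_def)
    then show ?R by blast
  next
    assume ?R
    then obtain a b c d where *: "(a, b) \<in> parcs G" "(c, d) \<in> parcs G" "a \<noteq> c"
      "(a, c) \<notin> parcs G" "(a, d) \<notin> parcs G" "(b, c) \<notin> parcs G" "(b, d) \<notin> parcs G"
      by blast
    \<comment> \<open>Each of these equalities would produce a loop or turn one of the two arcs into
      an excluded pair.\<close>
    moreover have "a \<noteq> b" "c \<noteq> d" "a \<noteq> d" "b \<noteq> c" "b \<noteq> d"
      using * no_loops' arc_sym_iff by blast+
    moreover have "(x, x) \<notin> parcs G" for x
      using no_loops' by blast
    moreover define f where "f = (\<lambda>i::nat. [a, b, c, d] ! i)"
    ultimately have "inj_on f (pverts two_K2)" "f ` pverts two_K2 \<subseteq> pverts G"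
      "\<forall>x\<in>pverts two_K2. \<forall>y\<in>pverts two_K2. (f x, f y) \<in> parcs G \<longleftrightarrow> (x, y) \<in> parcs two_K2"
      using arc_in_pverts arc_sym_iff by (auto simp: two_K2_def numeral_eq_Suc)
    then show ?E by blast
  qed
  with emb show ?thesis by blast
qed

section \<open>Families of internally disjoint paths\<close>

definition neighbours :: "'a \<Rightarrow> 'a set" where
  "neighbours u = {x. (u, x) \<in> parcs G}"

lemma neighbours_iff [simp]: "x \<in> neighbours u \<longleftrightarrow> (u, x) \<in> parcs G"
  by (simp add: neighbours_def)

lemma finite_neighbours [simp]: "finite (neighbours u)"
  by (rule finite_subset[OF _ finite_verts]) (use arc_in_pverts in auto)

lemma out_degree_eq_card_neighbours: "out_degree (with_proj G) u = card (neighbours u)"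
proof -
  have "out_arcs (with_proj G) u = Pair u ` neighbours u"
    by (auto simp: out_arcs_def)
  then show ?thesis
    by (simp add: out_degree_def card_image inj_on_def)
qed

lemma local_connectivity_eqI:
  assumes "internally_disjoint_paths G u v Q"
    and "\<And>Q'. internally_disjoint_paths G u v Q' \<Longrightarrow> card Q' \<le> card Q"
  shows "local_connectivity G u v = card Q"
  unfolding local_connectivity_def
  using assms internally_disjoint_paths_finite(2)[of u v] by (intro Max_eqI) auto

text \<open>The easy half of Menger's theorem: each path picks an inner vertex in \<open>X\<close>,
  and disjointness makes the choice injective.\<close>

lemma internally_disjoint_paths_card_le:
  assumes Q: "internally_disjoint_paths G u v Q" and "finite X"
    and hit: "\<And>p. p \<in> Q \<Longrightarrow> set (inner_verts p) \<inter> X \<noteq> {}"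
  shows "card Q \<le> card X"
proof -
  from hit have "\<forall>p\<in>Q. \<exists>x. x \<in> set (inner_verts p) \<inter> X"
    by blast
  then obtain h where h: "\<And>p. p \<in> Q \<Longrightarrow> h p \<in> set (inner_verts p) \<inter> X"
    by (metis (no_types))
  then have "inj_on h Q"
    using Q unfolding internally_disjoint_paths_def inj_on_def by (metis IntD1 IntI empty_iff)
  moreover have "h ` Q \<subseteq> X"
    using h by blast
  ultimately show ?thesis
    using \<open>finite X\<close> by (rule card_inj_on_le)
qed

text \<open>Induction along the walk with the start vertex free: a common neighbour of the second
  vertex and \<open>v\<close> found further on is also adjacent to \<open>u\<close>, unless the
  second vertex itself already serves.\<close>

lemma cograph_awalk_common_neighbour:
  assumes "cograph G" and "awalk u p v" and "u \<noteq> v" and "(u, v) \<notin> parcs G"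
  shows "set (inner_verts p) \<inter> (neighbours u \<inter> neighbours v) \<noteq> {}"
  using assms(2-)
proof (induction p arbitrary: u)
  case Nil
  then show ?case by (simp add: awalk_Nil_iff)
next
  case (Cons e p)
  then obtain w where e: "e = (u, w)" and uw: "(u, w) \<in> parcs G" and walk: "awalk w p v"
    by (cases e) (auto simp: awalk_Cons_iff)
  have "w \<noteq> v"
    using uw Cons.prems by auto
  then have w: "set (inner_verts (e # p)) = insert w (set (inner_verts p))"
    using walk by (cases p) (auto simp: awalk_simps inner_verts_def)
  show ?case
  proof (cases "(w, v) \<in> parcs G")
    case True
    then have "w \<in> neighbours u \<inter> neighbours v"
      using uw arc_sym_iff by auto
    then show ?thesis
      using w by blast
  next
    case False
    with Cons.IH walk \<open>w \<noteq> v\<close>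
    obtain y where y: "y \<in> set (inner_verts p)" "(w, y) \<in> parcs G" "(v, y) \<in> parcs G"
      by fastforce
    \<comment> \<open>In the path \<open>u w y v\<close> the chord \<open>wv\<close> is missing;
      were \<open>uy\<close> missing too, the ends \<open>u\<close> and \<open>v\<close> would have
      to be adjacent.\<close>
    have "(u, y) \<in> parcs G"
      using cograph_no_induced_P4[OF \<open>cograph G\<close> uw, of y v] y False Cons.prems arc_sym_iff by blast
    then have "y \<in> neighbours u \<inter> neighbours v"
      using y by simp
    then show ?thesis
      using w y by blast
  qed
qed

text \<open>The second vertex of such a path is a neighbour of \<open>u\<close> other than
  \<open>v\<close>, since a path arriving at \<open>v\<close> at once would have to stop there.
  Reversing the path gives the claim at \<open>v\<close>.\<close>

lemma apath_edge_or_inner: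
  assumes "apath u p v" and "u \<noteq> v" and "p \<noteq> [(u, v)]"
  shows "set (inner_verts p) \<inter> (neighbours u - {v}) \<noteq> {}"
    and "set (inner_verts p) \<inter> (neighbours v - {u}) \<noteq> {}"
proof -
  have first: "set (inner_verts p) \<inter> (neighbours u - {v}) \<noteq> {}"
    if path: "apath u p v" and "u \<noteq> v" and not_edge: "p \<noteq> [(u, v)]" for u v p
  proof (cases p)
    case Nil
    then show ?thesis using path \<open>u \<noteq> v\<close> by (simp add: apath_Nil_iff)
  next
    case (Cons e q)
    with path obtain w where e: "e = (u, w)" and uw: "(u, w) \<in> parcs G" and tail: "apath w q v"
      by (cases e) (auto simp: apath_Cons_iff)
    have "w \<noteq> v"
    proof
      assume "w = v"
      then have "q = []" using tail apath_nonempty_ends by blast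
      with not_edge Cons e \<open>w = v\<close> show False by simp
    qed
    then have "w \<in> set (inner_verts p)"
      using tail Cons by (cases q) (auto simp: apath_simps inner_verts_def)
    with uw \<open>w \<noteq> v\<close> show ?thesis by auto
  qed
  show "set (inner_verts p) \<inter> (neighbours u - {v}) \<noteq> {}"
    using assms by (rule first)
  have "rev_path p \<noteq> [(v, u)]"
    using assms(3) rev_path_eq[of p "[(u, v)]"] by simp
  then have "set (inner_verts (rev_path p)) \<inter> (neighbours v - {u}) \<noteq> {}"
    using assms by (intro first) auto
  then show "set (inner_verts p) \<inter> (neighbours v - {u}) \<noteq> {}"
    using assms inner_verts_rev_path[of u p v] by (simp add: apath_def)
qed

text \<open>The single-edge path has no inner vertex and is set aside, at a cost of one; all other
  paths are hit both by \<open>neighbours u - {v}\<close> and by \<open>neighbours v - {u}\<close>,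
  each one smaller than the degree.\<close>

lemma internally_disjoint_paths_card_le_degree:
  assumes Q: "internally_disjoint_paths G u v Q" and "(u, v) \<in> parcs G"
  shows "card Q \<le> min (card (neighbours u)) (card (neighbours v))"
proof -
  have "u \<noteq> v"
    using assms no_loops' by blast
  have Q': "internally_disjoint_paths G u v (Q - {[(u, v)]})"
    using Q by (auto simp: internally_disjoint_paths_def)
  then have path: "apath u p v" "p \<noteq> [(u, v)]" if "p \<in> Q - {[(u, v)]}" for p
    using that by (auto simp: internally_disjoint_paths_def)
  have "card (Q - {[(u, v)]}) \<le> card (neighbours u - {v})"
    using Q' path apath_edge_or_inner(1)[OF _ \<open>u \<noteq> v\<close>]
    by (intro internally_disjoint_paths_card_le) auto
  moreover have "card (Q - {[(u, v)]}) \<le> card (neighbours v - {u})"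
    using Q' path apath_edge_or_inner(2)[OF _ \<open>u \<noteq> v\<close>]
    by (intro internally_disjoint_paths_card_le) auto
  moreover have "card Q \<le> Suc (card (Q - {[(u, v)]}))"
    using internally_disjoint_paths_finite(1)[OF Q]
    by (metis Diff_empty Diff_insert0 Suc_le_eq card_Suc_Diff1 le_SucI order_refl)
  moreover have "Suc (card (neighbours u - {v})) = card (neighbours u)"
    "Suc (card (neighbours v - {u})) = card (neighbours v)"
    using assms arc_sym_iff by (simp_all add: card_Suc_Diff1 del: card_Diff_insert)
  ultimately show ?thesis by linarith
qed

section \<open>Local connectivity in cographs\<close>

lemma cograph_local_connectivity_nonadjacent:
  assumes "cograph G" and "u \<noteq> v" and "(u, v) \<notin> parcs G"
  shows "local_connectivity G u v = card (neighbours u \<inter> neighbours v)"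
proof -
  let ?C = "neighbours u \<inter> neighbours v"
  \<comment> \<open>The paths of length two attain the bound that the hitting set \<open>?C\<close>
    imposes.\<close>
  let ?Q = "(\<lambda>x. [(u, x), (x, v)]) ` ?C"
  have "internally_disjoint_paths G u v ?Q"
    using assms(2) arc_sym_iff arc_in_pverts no_loops'
    by (auto simp: internally_disjoint_paths_def apath_simps inner_verts_with_proj_def)
  moreover have "card ?Q = card ?C"
    by (intro card_image) (auto simp: inj_on_def)
  moreover have "card Q' \<le> card ?C" if "internally_disjoint_paths G u v Q'" for Q'
    using that cograph_awalk_common_neighbour[OF assms(1) _ assms(2,3)]
    by (intro internally_disjoint_paths_card_le)
      (auto simp: internally_disjoint_paths_def apath_def)
  ultimately show ?thesis
    using local_connectivity_eqI[of u v ?Q] by simp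
qed

lemma cograph_local_connectivity_adjacent:
  assumes "cograph G" and uv: "(u, v) \<in> parcs G"
  shows "local_connectivity G u v = min (card (neighbours u)) (card (neighbours v))"
proof -
  let ?C = "neighbours u \<inter> neighbours v"
  let ?A = "neighbours u - insert v ?C"
  let ?B = "neighbours v - insert u ?C"
  have vu: "(v, u) \<in> parcs G" and "u \<noteq> v" and "v \<in> pverts G"
    using uv arc_sym_iff no_loops' arc_in_pverts by blast+
  \<comment> \<open>Cutting \<open>?A\<close> down to the smaller of the two sizes leaves a set that
    injects into \<open>?B\<close>.\<close>
  obtain A where A: "A \<subseteq> ?A" "card A = min (card ?A) (card ?B)"
    by (meson min.cobounded1 obtain_subset_with_card_n)
  moreover have "finite A"
    using A(1) by (rule finite_subset) simp
  ultimately obtain f where f: "f ` A \<subseteq> ?B" "inj_on f A"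
    by (metis card_le_inj finite_Diff finite_neighbours min.cobounded2)
  have A_f: "(u, a) \<in> parcs G" "(v, a) \<notin> parcs G" "a \<noteq> v" "a \<noteq> u"
    "(v, f a) \<in> parcs G" "(u, f a) \<notin> parcs G" "u \<noteq> f a" "f a \<noteq> v" "a \<noteq> f a" if "a \<in> A" for a
  proof -
    have "a \<in> ?A" "f a \<in> ?B"
      using that A(1) f(1) by blast+
    then show "(u, a) \<in> parcs G" "(v, a) \<notin> parcs G" "a \<noteq> v" "a \<noteq> u"
      "(v, f a) \<in> parcs G" "(u, f a) \<notin> parcs G" "u \<noteq> f a" "f a \<noteq> v" "a \<noteq> f a"
      using no_loops' by auto
  qed
  have a_fa: "(a, f a) \<in> parcs G" if "a \<in> A" for a
    using cograph_no_induced_P4[OF assms(1), of a u v "f a"] A_f[OF that] uv arc_sym_iff by blast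
  let ?QC = "(\<lambda>x. [(u, x), (x, v)]) ` ?C"
  let ?QA = "(\<lambda>a. [(u, a), (a, f a), (f a, v)]) ` A"
  \<comment> \<open>The edge, a path of length two for each common neighbour and one of length three
    for each matched pair: \<open>Suc (card ?C + min (card ?A) (card ?B))\<close> in total, which is
    the smaller degree.\<close>
  let ?Q = "insert [(u, v)] (?QC \<union> ?QA)"
  have paths: "\<forall>p\<in>?Q. apath u p v"
    using uv \<open>u \<noteq> v\<close> \<open>v \<in> pverts G\<close> A_f a_fa arc_sym_iff no_loops'
    by (auto simp: apath_simps)
  \<comment> \<open>Members of \<open>A\<close> are adjacent to \<open>u\<close>, their partners are
    not. So two matched paths can only meet at equal positions, which injectivity of
    \<open>f\<close> excludes.\<close>
  have cross: "f a \<notin> A" if "a \<in> A" for a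
    using A_f that by metis
  have disj: "\<forall>p\<in>?Q. \<forall>q\<in>?Q. p \<noteq> q \<longrightarrow> set (inner_verts p) \<inter> set (inner_verts q) = {}"
    using A_f cross inj_on_eq_iff[OF f(2)]
    by (auto simp: inner_verts_with_proj_def dest: sym)
  have Q: "internally_disjoint_paths G u v ?Q"
    using paths disj by (simp add: internally_disjoint_paths_def)
  have "card ?Q = Suc (card (?QC \<union> ?QA))"
    using \<open>finite A\<close> by (subst card_insert_disjoint) auto
  also have "card (?QC \<union> ?QA) = card ?QC + card ?QA"
    using \<open>finite A\<close> by (intro card_Un_disjoint) auto
  also have "card ?QC = card ?C"
    by (intro card_image) (auto simp: inj_on_def)
  also have "card ?QA = card A"
    by (intro card_image) (auto simp: inj_on_def)
  finally have card_Q: "card ?Q = Suc (card ?C + min (card ?A) (card ?B))"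
    using A(2) by simp
  \<comment> \<open>The successor in each degree counts the other end of the edge
    \<open>uv\<close>.\<close>
  have "neighbours u = insert v (?C \<union> ?A)" "v \<notin> ?C \<union> ?A"
    using uv no_loops' by auto
  then have "card (neighbours u) = Suc (card (?C \<union> ?A))"
    by (metis card_insert_disjoint finite_Diff finite_Int finite_UnI finite_neighbours)
  also have "card (?C \<union> ?A) = card ?C + card ?A"
    by (intro card_Un_disjoint) auto
  finally have card_u: "card (neighbours u) = Suc (card ?C + card ?A)" .
  have "neighbours v = insert u (?C \<union> ?B)" "u \<notin> ?C \<union> ?B"
    using vu no_loops' by auto
  then have "card (neighbours v) = Suc (card (?C \<union> ?B))"
    by (metis card_insert_disjoint finite_Diff finite_Int finite_UnI finite_neighbours)
  also have "card (?C \<union> ?B) = card ?C + card ?B"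
    by (intro card_Un_disjoint) auto
  finally have card_v: "card (neighbours v) = Suc (card ?C + card ?B)" .
  have "card ?Q = min (card (neighbours u)) (card (neighbours v))"
    using card_Q card_u card_v by linarith
  then show ?thesis
    using local_connectivity_eqI[OF Q] internally_disjoint_paths_card_le_degree[OF _ uv] by simp
qed

text \<open>Adjacent pairs impose no condition. For the others, the intersection of two finite sets
  is as large as the smaller one exactly when the sets are nested.\<close>

lemma cograph_ideally_connected_iff:
  assumes "cograph G"
  shows "ideally_connected G \<longleftrightarrow>
    (\<forall>u\<in>pverts G. \<forall>v\<in>pverts G. u \<noteq> v \<longrightarrow> (u, v) \<notin> parcs G \<longrightarrow>
      neighbours u \<subseteq> neighbours v \<or> neighbours v \<subseteq> neighbours u)"
proof -
  have "card (X \<inter> Y) = min (card X) (card Y) \<longleftrightarrow> X \<subseteq> Y \<or> Y \<subseteq> X"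
    if "finite X" "finite Y" for X Y :: "'a set"
  proof
    assume "card (X \<inter> Y) = min (card X) (card Y)"
    then have "X \<inter> Y = X \<or> X \<inter> Y = Y"
      using that by (metis card_subset_eq inf_le1 inf_le2 min_def)
    then show "X \<subseteq> Y \<or> Y \<subseteq> X" by blast
  next
    assume "X \<subseteq> Y \<or> Y \<subseteq> X"
    then show "card (X \<inter> Y) = min (card X) (card Y)"
      using that by (auto simp: Int_absorb1 Int_absorb2 min_def dest: card_mono intro: antisym)
  qed
  then show ?thesis
    unfolding ideally_connected_def out_degree_eq_card_neighbours
    using cograph_local_connectivity_adjacent[OF assms] cograph_local_connectivity_nonadjacent[OF assms]
    by (metis (no_types, lifting) finite_neighbours)
qed

end

theorem theorem1p1:
  fixes G :: "'a pair_pre_digraph"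
  assumes "pair_graph G"
    and "cograph G"
  shows "ideally_connected G \<longleftrightarrow> induced_free two_K2 G"
proof -
  interpret pair_graph G by fact
  \<comment> \<open>Two neighbourhoods fail to be nested exactly when each has a private member,
    here \<open>a\<close> and \<open>b\<close>.\<close>
  have "\<not> ideally_connected G \<longleftrightarrow>
    (\<exists>u v a b. u \<noteq> v \<and> (u, v) \<notin> parcs G \<and> (u, a) \<in> parcs G \<and> (v, a) \<notin> parcs G \<and>
      (v, b) \<in> parcs G \<and> (u, b) \<notin> parcs G)"
    unfolding cograph_ideally_connected_iff[OF assms(2)]
    using arc_in_pverts by (fastforce simp: subset_iff)
  also have "\<dots> \<longleftrightarrow> \<not> induced_free two_K2 G"
  proof -
    \<comment> \<open>An edge \<open>ab\<close> would make \<open>u a b v\<close> an induced path.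
      Without it, the edges \<open>ua\<close> and \<open>vb\<close> form the forbidden pair.\<close>
    have "(a, b) \<notin> parcs G"
      if "u \<noteq> v" "(u, v) \<notin> parcs G" "(u, a) \<in> parcs G" "(v, a) \<notin> parcs G"
        "(v, b) \<in> parcs G" "(u, b) \<notin> parcs G" for u v a b
      using that cograph_no_induced_P4[OF assms(2), of u a b v] arc_sym_iff by blast
    then show ?thesis
      unfolding not_two_K2_free_iff using arc_sym_iff by blast
  qed
  finally show ?thesis by blast
qed

end
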